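(* Let $m\geq 1$ be an integer, let $(S,\cdot,\leq)$ be an ordered semigroup and let $B$ be an $m$-bi-interior ideal of $S$. Then $S$ is $m$-regular if and only if $(BS^mB]\cap(S^mBS^m]=B$.
   Context: An ordered semigroup $(S,\cdot,\leq)$ is a semigroup with a partial order such that $a\leq b$ implies $xa\leq xb$ and $ax\leq bx$ for all $a,b,x\in S$. For $A,B\subseteq S$, $AB=\{ab: a\in A, b\in B\}$ (with $a$ in place of $\{a\}$), and $S^m=S\cdots S$ ($m$ factors) is the set of all products of $m$ elements of $S$. For $H\subseteq S$, $(H]=\{t\in S: t\leq h \text{ for some } h\in H\}$. - $S$ is $m$-regular if $a\in(aS^ma]$ for all $a\in S$, i.e. for every $a\in S$ there is $x\in S^m$ with $a\leq axa$. - An $m$-bi-interior ideal of $S$ is a non-empty subset $B$ of $S$ (not required to be a subsemigroup) with $(BS^mB]\cap(S^mBS^m]\subseteq B$ and $(B]=B$.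
   Formalization: The equality is required for every m-bi-interior ideal B, not for one fixed B; for a fixed B the "if" part fails, e.g. B={0} in the null semigroup {0,n} with the discrete order satisfies the equality although the semigroup is not m-regular. *)

theory Defs
  imports "HOL-Library.Set_Algebras"
begin

class ordered_semigroup = semigroup_mult + order +
  assumes mult_left_mono_os: "a \<le> b \<Longrightarrow> x * a \<le> x * b"
    and mult_right_mono_os: "a \<le> b \<Longrightarrow> a * x \<le> b * x"

text \<open>
  A semigroup need not have a unit, so the library power is not available on its subsets.
  The \<open>m\<close>-fold product is meant for \<open>m \<ge> 1\<close>; for \<open>m = 0\<close> it takes the junk value \<open>A\<close>.
\<close>

definition set_pow :: "'a::semigroup_mult set \<Rightarrow> nat \<Rightarrow> 'a set" where
  "set_pow A m = ((\<lambda>X. A * X) ^^ (m - 1)) A"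

definition down :: "'a::order set \<Rightarrow> 'a set" where
  "down H = {t. \<exists>h\<in>H. t \<le> h}"

text \<open>The semigroup \<open>S\<close> is the whole type, hence \<open>S\<^sup>m\<close> is \<open>set_pow UNIV m\<close>.\<close>

definition m_regular :: "nat \<Rightarrow> 'a::ordered_semigroup itself \<Rightarrow> bool" where
  "m_regular m _ \<longleftrightarrow> (\<forall>a::'a. a \<in> down ({a} * set_pow UNIV m * {a}))"

definition m_bi_interior_ideal :: "nat \<Rightarrow> 'a::ordered_semigroup set \<Rightarrow> bool" where
  "m_bi_interior_ideal m B \<longleftrightarrow>
     B \<noteq> {} \<and>
     down (B * set_pow UNIV m * B) \<inter> down (set_pow UNIV m * B * set_pow UNIV m) \<subseteq> B \<and>
     down B = B"

end

theory Submission
  imports Defs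
begin

text \<open>
  The set \<open>S\<^sup>m\<close> is a two-sided ideal of \<open>S\<close>. If \<open>S\<close> is \<open>m\<close>-regular and \<open>a \<le> a x a\<close>, then
  \<open>a \<le> (a x) a (x a)\<close> puts \<open>a\<close> into \<open>(S\<^sup>m B S\<^sup>m]\<close> as well. Conversely, for any \<open>a\<close>
  the set \<open>B = ({a} \<union> a S\<^sup>m a]\<close> is an \<open>m\<close>-bi-interior ideal with \<open>B S\<^sup>m B \<subseteq> (a S\<^sup>m a]\<close>, so the
  equality for \<open>B\<close> yields \<open>a \<in> (a S\<^sup>m a]\<close>.
\<close>

text \<open>The new factor is absorbed by the outermost one, s(uv) = (su)v, so a case split on the
  iteration count suffices.\<close>

lemma set_pow_UNIV_mult_left:
  assumes "x \<in> set_pow UNIV m"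
  shows "s * x \<in> set_pow (UNIV::'a::semigroup_mult set) m"
proof -
  have "x \<in> ((\<lambda>X. UNIV * X) ^^ n) UNIV \<Longrightarrow> s * x \<in> ((\<lambda>X. UNIV * X) ^^ n) UNIV" for n
  proof (cases n)
    case (Suc k)
    assume "x \<in> ((\<lambda>X. UNIV * X) ^^ n) UNIV"
    then obtain u v where "v \<in> ((\<lambda>X. UNIV * X) ^^ k) UNIV" "x = u * v"
      using Suc by (auto elim: set_times_elim)
    then show ?thesis
      using set_times_intro[of "s * u" UNIV v] Suc by (simp add: mult.assoc)
  qed simp
  then show ?thesis
    using assms unfolding set_pow_def by blast
qed

text \<open>Here the absorbing factor is the innermost of the iteration, and induction carries
  \<open>s\<close> down to it.\<close>

lemma set_pow_UNIV_mult_right: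
  assumes "x \<in> set_pow UNIV m"
  shows "x * s \<in> set_pow (UNIV::'a::semigroup_mult set) m"
proof -
  have "x \<in> ((\<lambda>X. UNIV * X) ^^ n) UNIV \<Longrightarrow> x * s \<in> ((\<lambda>X. UNIV * X) ^^ n) UNIV" for n
  proof (induction n arbitrary: x)
    case (Suc k)
    then obtain u v where "v \<in> ((\<lambda>X. UNIV * X) ^^ k) UNIV" "x = u * v"
      by (auto elim: set_times_elim)
    then show ?case
      using set_times_intro[of u UNIV "v * s"] Suc.IH by (simp add: mult.assoc)
  qed simp
  then show ?thesis
    using assms unfolding set_pow_def by blast
qed

lemma mem_down_triple:
  fixes t :: "'a::{semigroup_mult, order}"
  shows "t \<in> down (A * C * B) \<longleftrightarrow> (\<exists>a\<in>A. \<exists>c\<in>C. \<exists>b\<in>B. t \<le> a * c * b)"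
  by (fastforce simp: down_def set_times_def)

lemma down_idem: "down (down H) = down H"
  by (auto simp: down_def intro: order_trans)

theorem theorem2p9:
  fixes m :: nat
  assumes "m \<ge> 1"
  shows "m_regular m TYPE('a::ordered_semigroup) \<longleftrightarrow>
    (\<forall>B::'a set. m_bi_interior_ideal m B \<longrightarrow>
       down (B * set_pow UNIV m * B) \<inter> down (set_pow UNIV m * B * set_pow UNIV m) = B)"
proof (intro iffI allI impI)
  fix B :: "'a set"
  assume reg: "m_regular m TYPE('a)" and ideal: "m_bi_interior_ideal m B"
  have "a \<in> down (B * set_pow UNIV m * B) \<inter> down (set_pow UNIV m * B * set_pow UNIV m)"
    if "a \<in> B" for a
  proof -
    obtain x where x: "x \<in> set_pow UNIV m" and le: "a \<le> a * x * a"
      using reg by (auto simp: m_regular_def mem_down_triple)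
    \<comment> \<open>Substituting the inequality into its own last factor creates a middle
      \<open>a\<close> flanked by \<open>a * x\<close> and \<open>x * a\<close>, both in the ideal
      S^m.\<close>
    have "a * x * a \<le> a * x * (a * x * a)"
      using le by (rule mult_left_mono_os)
    then have "a \<le> (a * x) * a * (x * a)"
      using le by (simp add: mult.assoc)
    then show ?thesis
      using that x le set_pow_UNIV_mult_left[OF x] set_pow_UNIV_mult_right[OF x]
      unfolding Int_iff mem_down_triple by blast
  qed
  with ideal show
    "down (B * set_pow UNIV m * B) \<inter> down (set_pow UNIV m * B * set_pow UNIV m) = B"
    by (auto simp: m_bi_interior_ideal_def)
next
  assume eq: "\<forall>B::'a set. m_bi_interior_ideal m B \<longrightarrow>
    down (B * set_pow UNIV m * B) \<inter> down (set_pow UNIV m * B * set_pow UNIV m) = B"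
  show "m_regular m TYPE('a)"
    unfolding m_regular_def
  proof
    fix a :: 'a
    let ?P = "set_pow (UNIV::'a set) m"
    \<comment> \<open>Adjoining \<open>a\<close> itself guarantees \<open>a \<in> B\<close> before
      regularity is known.\<close>
    define B where "B = down ({a} \<union> {a} * ?P * {a})"
    have B_elim: "t \<le> a \<or> (\<exists>x\<in>?P. t \<le> a * x * a)" if "t \<in> B" for t
      using that by (fastforce simp: B_def down_def set_times_def)
    \<comment> \<open>Either bound on \<open>b\<close> starts with \<open>a\<close>; whatever
      follows that \<open>a\<close> is absorbed into S^m by \<open>y\<close>.\<close>
    have left: "\<exists>z\<in>?P. b * y \<le> a * z" if "b \<in> B" "y \<in> ?P" for b y
      using B_elim[OF that(1)]
    proof
      assume "b \<le> a"
      then show ?thesis using that(2) by (blast intro: mult_right_mono_os)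
    next
      assume "\<exists>x\<in>?P. b \<le> a * x * a"
      then obtain x where "b \<le> a * x * a" by blast
      then have "b * y \<le> a * ((x * a) * y)"
        using mult_right_mono_os[of b "a * x * a" y] by (simp add: mult.assoc)
      then show ?thesis using set_pow_UNIV_mult_left[OF that(2)] by blast
    qed
    have right: "\<exists>z\<in>?P. y * c \<le> z * a" if "c \<in> B" "y \<in> ?P" for c y
      using B_elim[OF that(1)]
    proof
      assume "c \<le> a"
      then show ?thesis using that(2) by (blast intro: mult_left_mono_os)
    next
      assume "\<exists>x\<in>?P. c \<le> a * x * a"
      then obtain x where "c \<le> a * x * a" by blast
      then have "y * c \<le> (y * (a * x)) * a"
        using mult_left_mono_os[of c "a * x * a" y] by (simp add: mult.assoc)
      then show ?thesis using set_pow_UNIV_mult_right[OF that(2)] by blast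
    qed
    have sub: "down (B * ?P * B) \<subseteq> down ({a} * ?P * {a})"
    proof
      fix t
      assume "t \<in> down (B * ?P * B)"
      then obtain b y c where *: "b \<in> B" "y \<in> ?P" "c \<in> B" "t \<le> b * y * c"
        by (auto simp: mem_down_triple)
      \<comment> \<open>First \<open>b\<close> is traded for \<open>a\<close>; since
        \<open>z\<close> is again in S^m, \<open>right\<close> can then trade \<open>c\<close> for
        \<open>a\<close>.\<close>
      obtain z where z: "z \<in> ?P" "b * y \<le> a * z"
        using left * by blast
      obtain w where w: "w \<in> ?P" "z * c \<le> w * a"
        using right *(3) z(1) by blast
      have "t \<le> a * (z * c)"
        using *(4) mult_right_mono_os[OF z(2), of c] by (simp add: mult.assoc)
      also have "\<dots> \<le> a * w * a"
        using mult_left_mono_os[OF w(2), of a] by (simp add: mult.assoc)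
      finally show "t \<in> down ({a} * ?P * {a})"
        using w(1) by (auto simp: mem_down_triple)
    qed
    have aB: "a \<in> B"
      by (auto simp: B_def down_def)
    have "down ({a} * ?P * {a}) \<subseteq> B"
      by (auto simp: B_def down_def)
    \<comment> \<open>The intersection lies in its first set, which \<open>sub\<close> places inside
      (a S^m a] and hence inside \<open>B\<close>.\<close>
    then have "m_bi_interior_ideal m B"
      using sub aB down_idem[of "{a} \<union> {a} * ?P * {a}"]
      unfolding m_bi_interior_ideal_def B_def[symmetric] by blast
    \<comment> \<open>The equality puts \<open>a\<close> into (B S^m B], and \<open>sub\<close>
      takes it from there to (a S^m a].\<close>
    with eq aB sub show "a \<in> down ({a} * ?P * {a})"
      by blast
  qed
qed

end
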